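(* Let $f\in C([0,1])$ be of type A, B or C, with $f(0)=f(1)=0$, $\int_0^1f(s)\,ds>0$, and with some $k>0$ such that $|f(s)|\le ks$ and $|f(s)|\le k(1-s)$ for every $s\in[0,1]$. For $\varepsilon>0$ let $c^*_\varepsilon$ be the critical speed for $$\varepsilon\left(\frac{v'}{\sqrt{1-(v')^2}}\right)'-c\,v'+f(v)=0.$$ Then there exists $\bar c>0$ such that $c^*_\varepsilon\to\bar c$ for $\varepsilon\to0^+$.
   Context: Types of reaction terms $f$: - type A: $f(u)>0$ for every $u\in(0,1)$; - type B: there exists $\alpha\in(0,1)$ with $f(u)=0$ for $u\in[0,\alpha]$ and $f(u)>0$ for $u\in(\alpha,1)$; - type C: there exists $\alpha\in(0,1)$ with $f<0$ on $(0,\alpha)$ and $f>0$ on $(\alpha,1)$, and moreover $\int_0^1 f(s)\,ds\ge 0$. A number $c\in\mathbb{R}$ is called an admissible speed if the problem $$y'=c\,\frac{\sqrt{y(2\varepsilon+y)}}{\varepsilon+y}-f(v),\qquad y(0)=0,\ y(1)=0,\ y>0\text{ on }(0,1)$$ has a (classical) solution $y=y(v)$, $v\in[0,1]$ (equivalently, if the second-order equation has a monotone $C^2$ solution $v:\mathbb{R}\to[0,1]$ with $|v'|<1$, $v(-\infty)=0$, $v(+\infty)=1$). The set of admissible speeds is an interval $[c^*_\varepsilon,+\infty)$ if $f$ is of type A and a singleton $\{c^*_\varepsilon\}$ if $f$ is of type B or C; $c^*_\varepsilon$ is the critical speed. *)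

theory Defs
  imports "HOL-Analysis.Analysis"
begin

definition type_A :: "(real \<Rightarrow> real) \<Rightarrow> bool" where
  "type_A f \<longleftrightarrow> (\<forall>u\<in>{0<..<1}. f u > 0)"

definition type_B :: "(real \<Rightarrow> real) \<Rightarrow> bool" where
  "type_B f \<longleftrightarrow> (\<exists>\<alpha>\<in>{0<..<1}. (\<forall>u\<in>{0..\<alpha>}. f u = 0) \<and> (\<forall>u\<in>{\<alpha><..<1}. f u > 0))"

definition type_C :: "(real \<Rightarrow> real) \<Rightarrow> bool" where
  "type_C f \<longleftrightarrow>
     (\<exists>\<alpha>\<in>{0<..<1}. (\<forall>u\<in>{0<..<\<alpha>}. f u < 0) \<and> (\<forall>u\<in>{\<alpha><..<1}. f u > 0)) \<and>
     integral {0..1} f \<ge> 0"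

text \<open>
  First-order reduction of
  \<open>\<epsilon> (v' / sqrt (1 - v'^2))' - c v' + f(v) = 0\<close>:
  along a monotone front, \<open>y = \<epsilon> (1 / sqrt (1 - v'^2) - 1)\<close> as a function of \<open>v\<close>,
  so that \<open>v' = sqrt (y (2 \<epsilon> + y)) / (\<epsilon> + y)\<close>.
  Derivatives at the endpoints are one-sided.
\<close>

definition admissible_speed :: "(real \<Rightarrow> real) \<Rightarrow> real \<Rightarrow> real \<Rightarrow> bool" where
  "admissible_speed f \<epsilon> c \<longleftrightarrow>
     (\<exists>y :: real \<Rightarrow> real.
        (\<forall>v\<in>{0..1}. (y has_real_derivative
            c * (sqrt (y v * (2 * \<epsilon> + y v)) / (\<epsilon> + y v)) - f v) (at v within {0..1})) \<and>
        y 0 = 0 \<and> y 1 = 0 \<and> (\<forall>v\<in>{0<..<1}. y v > 0))"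

text \<open>
  The types exclude one another, so at most one disjunct applies.
\<close>

definition critical_speed :: "(real \<Rightarrow> real) \<Rightarrow> real \<Rightarrow> real" where
  "critical_speed f \<epsilon> =
     (THE c. (type_A f \<and> {c'. admissible_speed f \<epsilon> c'} = {c..}) \<or>
             ((type_B f \<or> type_C f) \<and> {c'. admissible_speed f \<epsilon> c'} = {c}))"

end

theory Submission
  imports Defs "HOL-Complex_Analysis.Great_Picard"
begin

text \<open>
  The limit is \<open>cbar = sup F(v) / v\<close> over \<open>0 < v \<le> 1\<close>, where \<open>F(v)\<close> is the integral of \<open>f\<close> from
  \<open>0\<close> to \<open>v\<close>. Write the first-order equation as \<open>y' = c g(y) - f(v)\<close>. Here
  \<open>g(y) = sqrt (y (2 \<epsilon> + y)) / (\<epsilon> + y)\<close> increases from \<open>0\<close> towards \<open>1\<close>, is not Lipschitz at \<open>0\<close>, and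
  tends to \<open>1\<close> as \<open>\<epsilon> \<rightarrow> 0\<close> for each fixed \<open>y > 0\<close>.

  Structure of the admissible speeds for fixed \<open>\<epsilon>\<close>. Extend \<open>g\<close> by \<open>0\<close> to negative arguments and solve
  backwards from \<open>y(1) = 0\<close>. A solution exists by Peano's theorem, and since \<open>g\<close> is monotone,
  subsolutions lie above solutions going backwards (\<open>backward_comparison\<close>). Hence for \<open>c \<ge> 0\<close> the
  solution \<open>y\<^sub>c\<close> is unique, nonincreasing and Lipschitz in \<open>c\<close>, so \<open>y\<^sub>c(0) \<le> 0\<close> holds exactly on a closed
  half-line \<open>[c\<^sup>*, \<infinity>)\<close>. All three types are covered by the assumption that \<open>f \<le> 0\<close> on \<open>[0, \<alpha>]\<close> and
  \<open>f > 0\<close> on \<open>(\<alpha>, 1)\<close>, with \<open>\<alpha> = 0\<close> for type A. Solutions are automatically positive on \<open>(\<alpha>, 1)\<close>, which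
  settles type A: every \<open>c \<ge> c\<^sup>*\<close> is admissible. On \<open>(0, \<alpha>)\<close> the function
  \<open>H = sqrt (y (2 \<epsilon> + y))\<close> satisfies \<open>H' = c - f / g(y) \<ge> c\<close>. Passing to the limit \<open>c \<rightarrow> c\<^sup>*\<close> from below in
  this inequality shows that \<open>c\<^sup>*\<close> is admissible (\<open>min_speed_solution_pos\<close>). Comparing \<open>H\<close> for two
  admissible speeds shows that there is only one if \<open>\<alpha> > 0\<close> (\<open>admissible_speed_unique\<close>).

  The limit. Since \<open>g \<le> 1\<close>, an admissible \<open>c\<close> satisfies \<open>0 \<le> y(v) \<le> c v - F(v)\<close>, so that \<open>cbar \<le> c\<^sup>*\<close> for
  every \<open>\<epsilon>\<close>. Conversely let \<open>cbar < l < c\<close>. Then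
  \<open>z(v) = sqrt (\<epsilon>\<^sup>2 + l\<^sup>2 v\<^sup>2) - \<epsilon>\<close>, the solution of \<open>z' = l g(z)\<close>, \<open>z(0) = 0\<close>, is a subsolution on a small
  interval \<open>[0, \<delta>]\<close>, because \<open>f(v) \<le> k v\<close>; on \<open>[\<delta>, 1]\<close> it is continued with slope \<open>l - f\<close>. The continuation
  stays above a positive constant because \<open>F(v) \<le> cbar v\<close>, and there \<open>c g \<ge> l\<close> once \<open>\<epsilon>\<close> is small. So
  \<open>y\<^sub>c(0) \<le> 0\<close>, that is, \<open>c\<^sup>* \<le> c\<close> for all small \<open>\<epsilon>\<close> (\<open>eventually_nonpos_at_0\<close>).
\<close>

section \<open>Peano's existence theorem\<close>

text \<open>
  Tonelli's proof: the equation in which the argument of \<open>y\<close> is delayed by \<open>1/(n+1)\<close> is solved by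
  finitely many iterations, and the solutions are equi-Lipschitz, so a subsequence converges by
  the Arzela-Ascoli theorem.
\<close>

lemma peano_existence:
  fixes h :: "real \<Rightarrow> real \<Rightarrow> real" and y0 M :: real
  assumes cont: "continuous_on ({0..1} \<times> UNIV) (\<lambda>(s, x). h s x)"
    and bound: "\<And>s x. s \<in> {0..1} \<Longrightarrow> \<bar>h s x\<bar> \<le> M"
  obtains y where "y 0 = y0"
    "\<And>t. t \<in> {0..1} \<Longrightarrow> (y has_real_derivative h t (y t)) (at t within {0..1})"
proof -
  have h_comp: "continuous_on {0..1} (\<lambda>s. h s (w s))" if "continuous_on {0..1} w" for w
  proof -
    have "continuous_on {0..1} (\<lambda>s. (\<lambda>(s, x). h s x) (s, w s))"
      by (rule continuous_on_compose2[OF cont]) (auto intro!: continuous_intros that)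
    then show ?thesis by simp
  qed
  \<comment> \<open>Row \<open>n\<close> iterates the delayed integral operator; each iteration extends the
    interval on which the iterates agree by \<open>1/(n+1)\<close>, so \<open>n+1\<close> iterations reach
    \<open>[0, 1]\<close>.\<close>
  define z where "z n = rec_nat (\<lambda>_. y0)
      (\<lambda>_ w v. y0 + integral {0..v} (\<lambda>s. h s (w (max 0 (s - 1 / real (Suc n))))))" for n
  have z_0: "z n 0 = (\<lambda>_. y0)" for n by (simp add: z_def)
  have z_Suc: "z n (Suc m) v = y0 + integral {0..v} (\<lambda>s. h s (z n m (max 0 (s - 1 / real (Suc n)))))" for n m v
    by (simp add: z_def)
  have delay_range: "max 0 (s - 1 / real (Suc n)) \<in> {0..1}" if "s \<in> {0..1}" for s n
  proof -
    have "0 \<le> 1 / real (Suc n)" by simp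
    then have "s - 1 / real (Suc n) \<le> 1" using that unfolding atLeastAtMost_iff by linarith
    then show ?thesis by simp
  qed
  have delay_cont: "continuous_on {0..1} (\<lambda>s. h s (w (max 0 (s - 1 / real (Suc n)))))"
    if "continuous_on {0..1} w" for w n
    using delay_range
    by (intro h_comp continuous_on_compose2[OF that] continuous_intros image_subsetI) auto
  have z_cont: "continuous_on {0..1} (z n m)" for n m
  proof (induction m)
    case 0 show ?case by (simp add: z_0)
  next
    case (Suc m)
    show ?case unfolding z_Suc
      by (intro continuous_intros indefinite_integral_continuous_1 integrable_continuous_real
          delay_cont Suc)
  qed
  have stable: "z n (Suc m) v = z n m v" if "v \<in> {0..1}" "v \<le> real m / real (Suc n)" for n m v
    using that
  proof (induction m arbitrary: v)
    case 0 then show ?case by (simp add: z_Suc z_0)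
  next
    case (Suc m)
    have "z n (Suc m) (max 0 (s - 1 / real (Suc n))) = z n m (max 0 (s - 1 / real (Suc n)))"
      if "s \<in> {0..v}" for s
    proof (rule Suc.IH)
      show "max 0 (s - 1 / real (Suc n)) \<in> {0..1}"
        using that Suc.prems by (intro delay_range) auto
      have "real (Suc m) / real (Suc n) = real m / real (Suc n) + 1 / real (Suc n)"
        by (simp add: add_divide_distrib)
      moreover have "0 \<le> real m / real (Suc n)" by simp
      ultimately show "max 0 (s - 1 / real (Suc n)) \<le> real m / real (Suc n)"
        using that Suc.prems unfolding atLeastAtMost_iff max_def by (auto split: if_splits)
    qed
    then show ?case
      unfolding z_Suc[of n "Suc m"] z_Suc[of n m v] by (intro arg_cong2[where f="(+)"] refl integral_cong) auto
  qed
  define y where "y n = z n (Suc n)" for n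
  have y_eq: "y n v = y0 + integral {0..v} (\<lambda>s. h s (y n (max 0 (s - 1 / real (Suc n)))))"
    if "v \<in> {0..1}" for n v
  proof -
    have "y n v = z n (Suc (Suc n)) v"
      unfolding y_def using stable[of v "Suc n" n] that by simp
    then show ?thesis unfolding z_Suc[of n "Suc n"] y_def .
  qed
  have y_cont: "continuous_on {0..1} (y n)" for n unfolding y_def by (rule z_cont)
  have M0: "0 \<le> M" using bound[of 0 0] by simp
  have y_lip0: "\<bar>y n v - y n u\<bar> \<le> M * (v - u)" if "0 \<le> u" "u \<le> v" "v \<le> 1" for n u v
  proof -
    let ?g = "\<lambda>s. h s (y n (max 0 (s - 1 / real (Suc n))))"
    have int: "?g integrable_on {0..v}"
      using that by (intro integrable_continuous_real continuous_on_subset[OF delay_cont[OF y_cont]]) auto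
    have "y n v - y n u = integral {u..v} ?g"
      using Henstock_Kurzweil_Integration.integral_combine[OF that(1,2) int] y_eq[of v] y_eq[of u] that by simp
    moreover have "norm (integral {u..v} ?g) \<le> M * (v - u)"
      using that by (intro integral_bound continuous_on_subset[OF delay_cont[OF y_cont]]) (auto intro: bound)
    ultimately show ?thesis by simp
  qed
  have y_lip: "\<bar>y n v - y n u\<bar> \<le> M * \<bar>v - u\<bar>" if "u \<in> {0..1}" "v \<in> {0..1}" for n u v
    using y_lip0[of u v n] y_lip0[of v u n] that by (cases "u \<le> v") (auto simp: abs_minus_commute)
  have y_at0: "y n 0 = y0" for n using y_eq[of 0 n] by simp
  have y_bound: "norm (y n x) \<le> \<bar>y0\<bar> + M" if "x \<in> {0..1}" for n x
  proof -
    have "\<bar>y n x - y0\<bar> \<le> M * x" using y_lip[of 0 x n] that y_at0 by auto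
    also have "\<dots> \<le> M" using that M0 by (simp add: mult_left_le)
    finally show ?thesis by simp
  qed
  obtain Y r where Y_cont: "continuous_on {0..1} Y" and r: "strict_mono (r :: nat \<Rightarrow> nat)"
    and conv: "\<And>e. 0 < e \<Longrightarrow> \<exists>N. \<forall>n x. n \<ge> N \<and> x \<in> {0..1} \<longrightarrow> norm (y (r n) x - Y x) < e"
  proof (rule Arzela_Ascoli[of "{0..1::real}" y "\<bar>y0\<bar> + M"])
    show "\<exists>d. 0 < d \<and> (\<forall>n u. u \<in> {0..1} \<and> norm (x - u) < d \<longrightarrow> norm (y n x - y n u) < e)"
      if "x \<in> {0..1}" "0 < e" for x e
    proof (intro exI[of _ "e / (M + 1)"] conjI allI impI)
      show "0 < e / (M + 1)" using that M0 by simp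
      fix n u assume u: "u \<in> {0..1} \<and> norm (x - u) < e / (M + 1)"
      then have "M * \<bar>x - u\<bar> \<le> (M + 1) * \<bar>x - u\<bar>" "(M + 1) * \<bar>x - u\<bar> < e" 
        using M0 by (auto simp: field_simps)
      then show "norm (y n x - y n u) < e" using y_lip[of u x n] u that by auto
    qed
  qed (use y_bound in auto)
  have y_tendsto: "(\<lambda>n. y (r n) x) \<longlonglongrightarrow> Y x" if "x \<in> {0..1}" for x
    unfolding LIMSEQ_iff using conv that by blast
  have delayed_tendsto: "(\<lambda>n. y (r n) (max 0 (s - 1 / real (Suc (r n))))) \<longlonglongrightarrow> Y s" if s: "s \<in> {0..1}" for s
  proof -
    have "(\<lambda>n. y (r n) (max 0 (s - 1 / real (Suc (r n)))) - y (r n) s) \<longlonglongrightarrow> 0"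
    proof (rule Lim_null_comparison)
      show "\<forall>\<^sub>F n in sequentially. norm (y (r n) (max 0 (s - 1 / real (Suc (r n)))) - y (r n) s)
          \<le> M * (1 / real (Suc (r n)))"
      proof (intro always_eventually allI)
        fix n
        let ?d = "1 / real (Suc (r n))"
        have "\<bar>y (r n) (max 0 (s - ?d)) - y (r n) s\<bar> \<le> M * \<bar>max 0 (s - ?d) - s\<bar>"
          using s delay_range by (intro y_lip)
        also have "\<dots> \<le> M * ?d" using s M0 by (intro mult_left_mono) (auto simp: max_def)
        finally show "norm (y (r n) (max 0 (s - ?d)) - y (r n) s) \<le> M * ?d" by simp
      qed
      have "(\<lambda>n. 1 / real (Suc (r n))) \<longlonglongrightarrow> 0"
        using LIMSEQ_subseq_LIMSEQ[OF LIMSEQ_inverse_real_of_nat r] by (simp add: o_def inverse_eq_divide)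
      then show "(\<lambda>n. M * (1 / real (Suc (r n)))) \<longlonglongrightarrow> 0"
        by (rule tendsto_mult_right_zero)
    qed
    from tendsto_add[OF this y_tendsto[OF s]] show ?thesis by simp
  qed
  have Y_eq: "Y v = y0 + integral {0..v} (\<lambda>s. h s (Y s))" if v: "v \<in> {0..1}" for v
  proof (rule LIMSEQ_unique[OF y_tendsto[OF v]])
    have "(\<lambda>n. integral {0..v} (\<lambda>s. h s (y (r n) (max 0 (s - 1 / real (Suc (r n)))))))
        \<longlonglongrightarrow> integral {0..v} (\<lambda>s. h s (Y s))"
    proof (rule dominated_convergence(2)[where h = "\<lambda>_. M"])
      show "(\<lambda>s. h s (y (r n) (max 0 (s - 1 / real (Suc (r n)))))) integrable_on {0..v}" for n
        using v by (intro integrable_continuous_real continuous_on_subset[OF delay_cont[OF y_cont]]) auto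
      show "norm (h s (y (r n) (max 0 (s - 1 / real (Suc (r n)))))) \<le> M" if "s \<in> {0..v}" for n s
        using that v by (auto intro: bound)
      show "(\<lambda>n. h s (y (r n) (max 0 (s - 1 / real (Suc (r n)))))) \<longlonglongrightarrow> h s (Y s)"
        if "s \<in> {0..v}" for s
      proof -
        have s: "s \<in> {0..1}" using that v by auto
        have "(\<lambda>n. (\<lambda>(s, x). h s x) (s, y (r n) (max 0 (s - 1 / real (Suc (r n))))))
           \<longlonglongrightarrow> (\<lambda>(s, x). h s x) (s, Y s)"
          using s by (intro continuous_on_tendsto_compose[OF cont] tendsto_intros delayed_tendsto) auto
        then show ?thesis by simp
      qed
    qed auto
    then show "(\<lambda>n. y (r n) v) \<longlonglongrightarrow> y0 + integral {0..v} (\<lambda>s. h s (Y s))"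
      unfolding y_eq[OF v] by (intro tendsto_intros)
  qed
  show thesis
  proof
    show "Y 0 = y0" using Y_eq[of 0] by simp
    fix t :: real assume t: "t \<in> {0..1}"
    have "((\<lambda>v. y0 + integral {0..v} (\<lambda>s. h s (Y s))) has_real_derivative h t (Y t)) (at t within {0..1})"
      by (auto intro!: derivative_eq_intros integral_has_real_derivative h_comp Y_cont t)
    then show "(Y has_real_derivative h t (Y t)) (at t within {0..1})"
      by (rule has_field_derivative_transform_within[OF _ zero_less_one t]) (simp add: Y_eq)
  qed
qed

section \<open>The nonlinearity and the backward problem\<close>

text \<open>
  The factor of \<open>c\<close> in the first-order equation, extended by \<open>0\<close> to \<open>y \<le> 0\<close> so that the equation
  makes sense for solutions that change sign.
\<close>

definition flux :: "real \<Rightarrow> real \<Rightarrow> real" where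
  "flux \<epsilon> y = sqrt (max 0 y * (2 * \<epsilon> + max 0 y)) / (\<epsilon> + max 0 y)"

lemma flux_nonpos: "y \<le> 0 \<Longrightarrow> flux \<epsilon> y = 0"
  by (simp add: flux_def max_def)

lemma flux_alt:
  assumes "\<epsilon> > 0"
  shows "flux \<epsilon> y = sqrt (1 - (\<epsilon> / (\<epsilon> + max 0 y))\<^sup>2)"
proof -
  define p where "p = max 0 y"
  have p: "\<epsilon> + p > 0" using assms by (simp add: p_def)
  have "1 - (\<epsilon> / (\<epsilon> + p))\<^sup>2 = p * (2 * \<epsilon> + p) / (\<epsilon> + p)\<^sup>2"
  proof -
    have "(\<epsilon> + p)\<^sup>2 - \<epsilon>\<^sup>2 = p * (2 * \<epsilon> + p)" by algebra
    moreover have "1 = (\<epsilon> + p)\<^sup>2 / (\<epsilon> + p)\<^sup>2" using p by simp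
    ultimately show ?thesis by (metis diff_divide_distrib power_divide)
  qed
  then show ?thesis
    using p by (simp add: flux_def p_def[symmetric] real_sqrt_divide)
qed

lemma flux_mono:
  assumes "\<epsilon> > 0" "y \<le> z"
  shows "flux \<epsilon> y \<le> flux \<epsilon> z"
proof -
  have "\<epsilon> / (\<epsilon> + max 0 z) \<le> \<epsilon> / (\<epsilon> + max 0 y)"
    using assms by (intro divide_left_mono) (auto intro!: mult_pos_pos)
  then have "(\<epsilon> / (\<epsilon> + max 0 z))\<^sup>2 \<le> (\<epsilon> / (\<epsilon> + max 0 y))\<^sup>2"
    using assms by (intro power_mono) auto
  then show ?thesis using assms by (simp add: flux_alt)
qed

lemma flux_nonneg: "\<epsilon> > 0 \<Longrightarrow> 0 \<le> flux \<epsilon> y"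
  by (simp add: flux_def)

lemma flux_le_1: "\<epsilon> > 0 \<Longrightarrow> flux \<epsilon> y \<le> 1"
  by (simp add: flux_alt)

lemma flux_pos: "\<epsilon> > 0 \<Longrightarrow> y > 0 \<Longrightarrow> 0 < flux \<epsilon> y"
  by (simp add: flux_def max_def)

lemma continuous_on_flux: "\<epsilon> > 0 \<Longrightarrow> continuous_on UNIV (flux \<epsilon>)"
  unfolding flux_def
  by (intro continuous_intros ballI) (metis add_pos_nonneg max.cobounded1 less_irrefl)

lemma tendsto_flux_at_right_0:
  assumes "y > 0"
  shows "((\<lambda>\<epsilon>. flux \<epsilon> y) \<longlongrightarrow> 1) (at_right 0)"
proof -
  have "((\<lambda>\<epsilon>. flux \<epsilon> y) \<longlongrightarrow> sqrt (max 0 y * (2 * 0 + max 0 y)) / (0 + max 0 y)) (at_right 0)"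
    unfolding flux_def using assms by (intro tendsto_intros) auto
  then show ?thesis using assms by (simp add: max_def)
qed

text \<open>
  A function that cannot increase while it is negative never recovers once it is negative.
\<close>

lemma nonneg_if_final_nonneg:
  fixes \<phi> \<phi>' :: "real \<Rightarrow> real"
  assumes cont: "continuous_on {a..b} \<phi>"
    and deriv: "\<And>v. \<lbrakk>a < v; v < b\<rbrakk> \<Longrightarrow> (\<phi> has_real_derivative \<phi>' v) (at v)"
    and sign: "\<And>v. \<lbrakk>a < v; v < b; \<phi> v < 0\<rbrakk> \<Longrightarrow> \<phi>' v \<le> 0"
    and final: "0 \<le> \<phi> b" and v: "a \<le> v" "v \<le> b"
  shows "0 \<le> \<phi> v"
proof (rule ccontr)
  assume neg: "\<not> 0 \<le> \<phi> v"
  \<comment> \<open>The first time after \<open>v\<close> at which \<open>\<phi>\<close> is nonnegative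
    again.\<close>
  define S where "S = {v..b} \<inter> \<phi> -` {0..}"
  have contv: "continuous_on {v..b} \<phi>"
    using cont v by (auto intro: continuous_on_subset)
  have "closed S"
    unfolding S_def by (intro continuous_closed_preimage contv) auto
  then have "compact S"
    by (metis S_def compact_Icc compact_Int_closed inf.absorb_iff2 inf_le1)
  moreover have "b \<in> S" using final v by (auto simp: S_def)
  ultimately obtain t where t: "t \<in> S" "\<And>s. s \<in> S \<Longrightarrow> t \<le> s"
    using compact_attains_inf[of S] by auto
  have before: "\<phi> s < 0" if "v \<le> s" "s < t" for s
    using t(2)[of s] t(1) that by (cases "0 \<le> \<phi> s") (auto simp: S_def)
  have "\<phi> t \<le> \<phi> v"
  proof (rule DERIV_nonpos_imp_decreasing_open[where f = \<phi>])
    show "v \<le> t" using t(1) by (auto simp: S_def)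
    show "\<exists>d. (\<phi> has_real_derivative d) (at s) \<and> d \<le> 0" if "v < s" "s < t" for s
      using deriv[of s] sign[of s] before[of s] that v t(1) by (auto simp: S_def)
    show "continuous_on {v..t} \<phi>"
      using t(1) by (intro continuous_on_subset[OF contv]) (auto simp: S_def)
  qed
  then show False using neg t(1) by (auto simp: S_def)
qed

text \<open>
  Solutions of the extended equation on \<open>[0, 1]\<close> with terminal value \<open>0\<close>; the value at \<open>0\<close> and the
  sign are left free.
\<close>

definition backward_solution :: "(real \<Rightarrow> real) \<Rightarrow> real \<Rightarrow> real \<Rightarrow> (real \<Rightarrow> real) \<Rightarrow> bool" where
  "backward_solution f \<epsilon> c y \<longleftrightarrow>
     (\<forall>v\<in>{0..1}. (y has_real_derivative c * flux \<epsilon> (y v) - f v) (at v within {0..1})) \<and> y 1 = 0"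

lemma backward_solution_cont: "backward_solution f \<epsilon> c y \<Longrightarrow> continuous_on {0..1} y"
  unfolding backward_solution_def
  by (meson continuous_on_eq_continuous_within has_field_derivative_imp_has_derivative has_derivative_continuous)

lemma backward_solution_DERIV:
  assumes "backward_solution f \<epsilon> c y" "0 < v" "v < 1"
  shows "(y has_real_derivative c * flux \<epsilon> (y v) - f v) (at v)"
  using assms at_within_interior[of v "{0..1::real}"]
  by (auto simp: backward_solution_def dest!: bspec[of _ _ v])

text \<open>
  An admissible speed is one whose backward solution also vanishes at \<open>0\<close> and is positive in between.
\<close>

lemma admissible_speed_altdef:
  "admissible_speed f \<epsilon> c \<longleftrightarrow>
     (\<exists>y. backward_solution f \<epsilon> c y \<and> y 0 = 0 \<and> (\<forall>v\<in>{0<..<1}. y v > 0))"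
proof -
  have *: "flux \<epsilon> (y v) = sqrt (y v * (2 * \<epsilon> + y v)) / (\<epsilon> + y v)"
    if "y 0 = 0" "y 1 = 0" "\<forall>v\<in>{0<..<1}. y v > 0" "v \<in> {0..1}" for y :: "real \<Rightarrow> real" and v
  proof -
    have "0 \<le> y v" using that by (cases "v = 0 \<or> v = 1") (auto simp: less_imp_le)
    then show ?thesis by (simp add: flux_def max_def)
  qed
  show ?thesis
    unfolding admissible_speed_def backward_solution_def by (intro iff_exI) (auto simp: *)
qed

text \<open>
  A subsolution \<open>z\<close> that lies above the solution at the right end lies above it on the whole
  interval: where \<open>z < y\<close>, monotonicity of the flux makes \<open>z - y\<close> nonincreasing, so \<open>z\<close> could not
  catch up. The comparison on subintervals allows subsolutions to be glued.
\<close>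

lemma backward_comparison:
  fixes y z z' :: "real \<Rightarrow> real"
  assumes "\<epsilon> > 0" "c \<ge> 0" "0 \<le> a" "b \<le> 1" and y: "backward_solution f \<epsilon> c y"
    and z: "continuous_on {a..b} z"
      "\<And>v. \<lbrakk>a < v; v < b\<rbrakk> \<Longrightarrow> (z has_real_derivative z' v) (at v)"
      "\<And>v. \<lbrakk>a < v; v < b\<rbrakk> \<Longrightarrow> z' v \<le> c * flux \<epsilon> (z v) - f v"
    and final: "y b \<le> z b" and v: "a \<le> v" "v \<le> b"
  shows "y v \<le> z v"
proof -
  have "0 \<le> z v - y v"
  proof (rule nonneg_if_final_nonneg[where a = a and b = b and \<phi> = "\<lambda>v. z v - y v"
        and \<phi>' = "\<lambda>v. z' v - (c * flux \<epsilon> (y v) - f v)"])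
    show "continuous_on {a..b} (\<lambda>v. z v - y v)"
      using assms(3,4) by (intro continuous_intros z continuous_on_subset[OF backward_solution_cont[OF y]]) auto
    fix s assume s: "a < s" "s < b"
    show "((\<lambda>v. z v - y v) has_real_derivative z' s - (c * flux \<epsilon> (y s) - f s)) (at s)"
      using s assms(3,4) by (intro DERIV_diff z backward_solution_DERIV[OF y]) auto
    assume "z s - y s < 0"
    then have "c * flux \<epsilon> (z s) \<le> c * flux \<epsilon> (y s)"
      using assms by (intro mult_left_mono flux_mono) auto
    then show "z' s - (c * flux \<epsilon> (y s) - f s) \<le> 0" using z(3)[OF s] by simp
  qed (use final v in auto)
  then show ?thesis by simp
qed

lemma backward_solution_exists:
  assumes "\<epsilon> > 0" and f: "continuous_on {0..1} f"
  obtains y where "backward_solution f \<epsilon> c y"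
proof -
  \<comment> \<open>Reversing the orientation of \<open>[0, 1]\<close> turns the terminal condition into an
    initial one.\<close>
  have f_rev: "continuous_on {0..1} (\<lambda>t. f (1 - t))"
    by (rule continuous_on_compose2[OF f]) (auto intro!: continuous_intros)
  obtain B where B: "\<And>s. s \<in> {0..1} \<Longrightarrow> \<bar>f s\<bar> \<le> B"
    using compact_imp_bounded[OF compact_continuous_image[OF f compact_Icc]]
    unfolding bounded_iff by fastforce
  obtain w where w: "w 0 = 0"
    "\<And>t. t \<in> {0..1} \<Longrightarrow> (w has_real_derivative f (1 - t) - c * flux \<epsilon> (w t)) (at t within {0..1})"
  proof (rule peano_existence[of "\<lambda>t x. f (1 - t) - c * flux \<epsilon> x" "B + \<bar>c\<bar>" 0])
    show "continuous_on ({0..1} \<times> UNIV) (\<lambda>(t, x). f (1 - t) - c * flux \<epsilon> x)"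
      unfolding split_beta
      by (intro continuous_intros continuous_on_compose2[OF f_rev] 
           continuous_on_compose2[OF continuous_on_flux[OF \<open>\<epsilon> > 0\<close>]]) auto
    show "\<bar>f (1 - s) - c * flux \<epsilon> x\<bar> \<le> B + \<bar>c\<bar>" if "s \<in> {0..1}" for s x
    proof -
      have "\<bar>c * flux \<epsilon> x\<bar> \<le> \<bar>c\<bar>"
        using flux_nonneg[of \<epsilon> x] flux_le_1[of \<epsilon> x] assms(1) by (simp add: abs_mult mult_left_le)
      then show ?thesis using B[of "1 - s"] that by auto
    qed
  qed auto
  have "((\<lambda>v. w (1 - v)) has_real_derivative c * flux \<epsilon> (w (1 - v)) - f v) (at v within {0..1})"
    if v: "v \<in> {0..1}" for v
  proof -
    have img: "(\<lambda>v. 1 - v) ` {0..1} = {0..1::real}"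
      by (auto simp: image_iff intro: bexI[of _ "1 - _"])
    have "(w \<circ> (\<lambda>v. 1 - v) has_real_derivative (f (1 - (1 - v)) - c * flux \<epsilon> (w (1 - v))) * (0 - 1)) (at v within {0..1})"
      by (rule DERIV_image_chain) (use w(2)[of "1 - v"] v img in \<open>auto intro!: derivative_eq_intros\<close>)
    then show ?thesis by (simp add: o_def)
  qed
  then have "backward_solution f \<epsilon> c (\<lambda>v. w (1 - v))"
    using w(1) by (simp add: backward_solution_def)
  then show thesis by (rule that)
qed


section \<open>The limiting speed\<close>

text \<open>
  The antiderivative of \<open>f\<close> that vanishes at \<open>0\<close>.
\<close>

definition primitive :: "(real \<Rightarrow> real) \<Rightarrow> real \<Rightarrow> real" where
  "primitive f v = integral {0..v} f"

text \<open>
  The supremum of the slopes of the chords of the primitive from \<open>0\<close>. It is the least \<open>c\<close> for which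
  the formal limit \<open>c v - F(v)\<close> of the solutions stays nonnegative.
\<close>

definition limit_speed :: "(real \<Rightarrow> real) \<Rightarrow> real" where
  "limit_speed f = (SUP v\<in>{0<..1}. primitive f v / v)"

text \<open>
  The substitution that removes the singularity at \<open>y = 0\<close>: the derivative of
  \<open>sqrt (y (2 \<epsilon> + y))\<close> with respect to \<open>y\<close> is the reciprocal of the flux.
\<close>

lemma flux_potential_deriv:
  assumes "\<epsilon> > 0" "y v > 0" and y: "(y has_real_derivative c * flux \<epsilon> (y v) - f v) (at v)"
  shows "((\<lambda>v. sqrt (y v * (2 * \<epsilon> + y v))) has_real_derivative c - f v / flux \<epsilon> (y v)) (at v)"
proof -
  have pos: "y v * (2 * \<epsilon> + y v) > 0" using assms by simp
  have flux: "flux \<epsilon> (y v) = sqrt (y v * (2 * \<epsilon> + y v)) / (\<epsilon> + y v)"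
    using assms by (simp add: flux_def max_def)
  let ?D = "c * flux \<epsilon> (y v) - f v"
  have "((\<lambda>v. sqrt (y v * (2 * \<epsilon> + y v))) has_real_derivative
      (?D * (2 * \<epsilon> + y v) + ?D * y v) * (inverse (sqrt (y v * (2 * \<epsilon> + y v))) / 2)) (at v)"
    using pos by (auto intro!: derivative_eq_intros y)
  moreover have "(?D * (2 * \<epsilon> + y v) + ?D * y v) * (inverse (sqrt (y v * (2 * \<epsilon> + y v))) / 2)
      = ?D / flux \<epsilon> (y v)"
  proof -
    have "?D * (2 * \<epsilon> + y v) + ?D * y v = ?D * (\<epsilon> + y v) * 2" by algebra
    then show ?thesis unfolding flux by (simp add: inverse_eq_divide)
  qed
  moreover have "\<dots> = c - f v / flux \<epsilon> (y v)"
    using flux_pos[OF assms(1,2)] by (simp add: field_simps)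
  ultimately show ?thesis by (simp only:)
qed

section \<open>Backward solutions for reactions with a threshold\<close>

text \<open>
  Reactions that are nonpositive up to a threshold \<open>\<alpha>\<close> and positive beyond it, with positive total
  integral and at most linear growth at \<open>0\<close>. Type A corresponds to \<open>\<alpha> = 0\<close>, types B and C to
  \<open>0 < \<alpha> < 1\<close>.
\<close>

locale threshold_reaction =
  fixes f :: "real \<Rightarrow> real" and k \<alpha> :: real
  assumes f_cont: "continuous_on {0..1} f"
    and k_pos: "k > 0"
    and f_bound: "\<And>s. s \<in> {0..1} \<Longrightarrow> \<bar>f s\<bar> \<le> k * s"
    and total_pos: "integral {0..1} f > 0"
    and \<alpha>: "0 \<le> \<alpha>" "\<alpha> < 1"
    and f_left: "\<And>s. \<lbrakk>0 \<le> s; s \<le> \<alpha>\<rbrakk> \<Longrightarrow> f s \<le> 0"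
    and f_right: "\<And>s. \<lbrakk>\<alpha> < s; s < 1\<rbrakk> \<Longrightarrow> 0 < f s"
begin

lemma primitive_cont: "continuous_on {0..1} (primitive f)"
  unfolding primitive_def by (intro indefinite_integral_continuous_1 integrable_continuous_real f_cont)

lemma primitive_DERIV:
  assumes "0 < v" "v < 1"
  shows "(primitive f has_real_derivative f v) (at v)"
  using integral_has_real_derivative[OF f_cont, of v] assms at_within_interior[of v "{0..1::real}"]
  by (simp add: primitive_def[abs_def])

lemma primitive_0: "primitive f 0 = 0" by (simp add: primitive_def)

lemma primitive_1_pos: "0 < primitive f 1" using total_pos by (simp add: primitive_def)

lemma abs_primitive_le:
  assumes "0 \<le> v" "v \<le> 1"
  shows "\<bar>primitive f v\<bar> \<le> k * v * v"
proof -
  have "norm (integral {0..v} f) \<le> k * v * (v - 0)"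
  proof (rule integral_bound)
    show "continuous_on {0..v} f" using assms by (auto intro: continuous_on_subset[OF f_cont])
    fix s assume s: "s \<in> {0..v}"
    then have "\<bar>f s\<bar> \<le> k * s" using f_bound[of s] assms by auto
    also have "\<dots> \<le> k * v" using s k_pos by auto
    finally show "norm (f s) \<le> k * v" by simp
  qed (use assms in auto)
  then show ?thesis by (simp add: primitive_def)
qed

lemma primitive_le_limit_speed:
  assumes "0 < v" "v \<le> 1"
  shows "primitive f v \<le> limit_speed f * v"
proof -
  have "bdd_above ((\<lambda>v. primitive f v / v) ` {0<..1})"
  proof (rule bdd_aboveI2[where M = k])
    fix s :: real assume s: "s \<in> {0<..1}"
    have "k * s * s \<le> k * s" using s k_pos by (intro mult_left_le) auto
    then show "primitive f s / s \<le> k" using abs_primitive_le[of s] s by (auto simp: field_simps)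
  qed
  then have "primitive f v / v \<le> limit_speed f"
    unfolding limit_speed_def using assms by (intro cSUP_upper) auto
  then show ?thesis using assms by (simp add: field_simps)
qed

lemma limit_speed_pos: "0 < limit_speed f"
  using primitive_le_limit_speed[of 1] primitive_1_pos by simp

lemma solution_pos_right:
  assumes "\<epsilon> > 0" and y: "backward_solution f \<epsilon> c y" and v: "\<alpha> < v" "v < 1"
  shows "0 < y v"
proof (rule ccontr)
  assume "\<not> 0 < y v"
  have nonneg: "0 \<le> y s" if s: "\<alpha> \<le> s" "s \<le> 1" for s
  proof (rule nonneg_if_final_nonneg[where \<phi> = y and a = \<alpha> and b = 1 and \<phi>' = "\<lambda>v. c * flux \<epsilon> (y v) - f v"])
    show "continuous_on {\<alpha>..1} y"
      using \<alpha> by (auto intro: continuous_on_subset[OF backward_solution_cont[OF y]])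
    show "(y has_real_derivative c * flux \<epsilon> (y s) - f s) (at s)" if "\<alpha> < s" "s < 1" for s
      using that \<alpha> by (intro backward_solution_DERIV[OF y]) auto
    show "c * flux \<epsilon> (y s) - f s \<le> 0" if "\<alpha> < s" "s < 1" "y s < 0" for s
      using that f_right[of s] by (simp add: flux_nonpos)
    show "0 \<le> y 1" using y by (simp add: backward_solution_def)
  qed (use s in auto)
  \<comment> \<open>It remains to exclude a zero of \<open>y\<close>: there \<open>y' = - f < 0\<close>, so
    \<open>y\<close> would become negative.\<close>
  have "y v = 0" using nonneg[of v] v \<open>\<not> 0 < y v\<close> by auto
  then have "(y has_real_derivative - f v) (at v)"
    using backward_solution_DERIV[OF y, of v] v \<alpha> by (simp add: flux_nonpos)
  from DERIV_neg_dec_right[OF this] obtain d where d: "d > 0" "\<And>h. 0 < h \<Longrightarrow> h < d \<Longrightarrow> y (v + h) < y v"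
    using f_right[OF v] by auto
  define h where "h = min (d / 2) ((1 - v) / 2)"
  have "0 < h" "h < d" "v + h < 1" using d v unfolding h_def min_def by (auto simp: field_simps)
  then show False using d(2)[of h] nonneg[of "v + h"] \<open>y v = 0\<close> v by auto
qed

lemma solution_antimono:
  assumes "\<epsilon> > 0" "0 \<le> c1" "c1 \<le> c2"
    and y1: "backward_solution f \<epsilon> c1 y1" and y2: "backward_solution f \<epsilon> c2 y2"
    and v: "0 \<le> v" "v \<le> 1"
  shows "y2 v \<le> y1 v"
proof (rule backward_comparison[OF assms(1) _ order_refl order_refl y2, where z' = "\<lambda>v. c1 * flux \<epsilon> (y1 v) - f v"])
  show "continuous_on {0..1} y1" by (rule backward_solution_cont[OF y1])
  show "(y1 has_real_derivative c1 * flux \<epsilon> (y1 v) - f v) (at v)" if "0 < v" "v < 1" for v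
    by (rule backward_solution_DERIV[OF y1 that])
  show "c1 * flux \<epsilon> (y1 v) - f v \<le> c2 * flux \<epsilon> (y1 v) - f v" for v
    using assms flux_nonneg[of \<epsilon> "y1 v"] by (simp add: mult_right_mono)
qed (use assms in \<open>auto simp: backward_solution_def\<close>)

lemma solution_lipschitz:
  assumes "\<epsilon> > 0" "0 \<le> c1" "c1 \<le> c2"
    and y1: "backward_solution f \<epsilon> c1 y1" and y2: "backward_solution f \<epsilon> c2 y2"
    and v: "0 \<le> v" "v \<le> 1"
  shows "y1 v \<le> y2 v + (c2 - c1) * (1 - v)"
proof (rule backward_comparison[OF assms(1,2) order_refl order_refl y1,
      where z = "\<lambda>v. y2 v + (c2 - c1) * (1 - v)"
      and z' = "\<lambda>v. c2 * flux \<epsilon> (y2 v) - f v - (c2 - c1)"])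
  show "continuous_on {0..1} (\<lambda>v. y2 v + (c2 - c1) * (1 - v))"
    by (intro continuous_intros backward_solution_cont[OF y2])
  fix v :: real assume v: "0 < v" "v < 1"
  show "((\<lambda>v. y2 v + (c2 - c1) * (1 - v)) has_real_derivative c2 * flux \<epsilon> (y2 v) - f v - (c2 - c1)) (at v)"
    by (auto intro!: derivative_eq_intros backward_solution_DERIV[OF y2 v])
  have "(c2 - c1) * flux \<epsilon> (y2 v) \<le> c2 - c1"
    using assms flux_le_1[of \<epsilon> "y2 v"] by (simp add: mult_left_le)
  moreover have "c1 * flux \<epsilon> (y2 v) \<le> c1 * flux \<epsilon> (y2 v + (c2 - c1) * (1 - v))"
    using assms v by (intro mult_left_mono flux_mono) auto
  ultimately show "c2 * flux \<epsilon> (y2 v) - f v - (c2 - c1) \<le> c1 * flux \<epsilon> (y2 v + (c2 - c1) * (1 - v)) - f v"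
    by (simp add: algebra_simps)
qed (use assms in \<open>auto simp: backward_solution_def\<close>)

text \<open>
  The flux is at most \<open>1\<close>, hence \<open>y' \<le> c - f\<close>.
\<close>

lemma solution_le_line:
  assumes "\<epsilon> > 0" "0 \<le> c" and y: "backward_solution f \<epsilon> c y" and v: "0 \<le> v" "v \<le> 1"
  shows "y v \<le> y 0 + c * v - primitive f v"
proof -
  have "y v + primitive f v - c * v \<le> y 0 + primitive f 0 - c * 0"
  proof (rule DERIV_nonpos_imp_decreasing_open[where f = "\<lambda>v. y v + primitive f v - c * v", OF v(1)])
    fix s assume s: "0 < s" "s < v"
    show "\<exists>d. ((\<lambda>v. y v + primitive f v - c * v) has_real_derivative d) (at s) \<and> d \<le> 0"
    proof (intro exI conjI)
      show "((\<lambda>v. y v + primitive f v - c * v) has_real_derivative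
          (c * flux \<epsilon> (y s) - f s + f s - c)) (at s)"
        using s v by (auto intro!: derivative_eq_intros backward_solution_DERIV[OF y] primitive_DERIV)
      show "c * flux \<epsilon> (y s) - f s + f s - c \<le> 0"
        using assms flux_le_1[of \<epsilon> "y s"] by (simp add: mult_left_le)
    qed
  next
    show "continuous_on {0..v} (\<lambda>v. y v + primitive f v - c * v)"
      using v by (intro continuous_intros continuous_on_subset[OF backward_solution_cont[OF y]]
          continuous_on_subset[OF primitive_cont]) auto
  qed
  then show ?thesis by (simp add: primitive_0)
qed

lemma admissible_speed_nonneg:
  assumes "\<epsilon> > 0" "admissible_speed f \<epsilon> c"
  shows "0 \<le> c"
proof (rule ccontr)
  assume "\<not> 0 \<le> c"
  obtain y where y: "backward_solution f \<epsilon> c y" "y 0 = 0"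
    using assms by (auto simp: admissible_speed_altdef)
  have "y 1 + primitive f 1 \<le> y 0 + primitive f 0"
  proof (rule DERIV_nonpos_imp_decreasing_open[where f = "\<lambda>v. y v + primitive f v"])
    fix s :: real assume s: "0 < s" "s < 1"
    show "\<exists>d. ((\<lambda>v. y v + primitive f v) has_real_derivative d) (at s) \<and> d \<le> 0"
    proof (intro exI conjI)
      show "((\<lambda>v. y v + primitive f v) has_real_derivative c * flux \<epsilon> (y s) - f s + f s) (at s)"
        using s by (auto intro!: derivative_eq_intros backward_solution_DERIV[OF y(1)] primitive_DERIV)
      show "c * flux \<epsilon> (y s) - f s + f s \<le> 0"
        using assms \<open>\<not> 0 \<le> c\<close> flux_nonneg[of \<epsilon> "y s"] by (simp add: mult_nonpos_nonneg)
    qed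
  qed (auto intro!: continuous_intros backward_solution_cont[OF y(1)] primitive_cont)
  then show False using y primitive_1_pos primitive_0 by (simp add: backward_solution_def)
qed

lemma limit_speed_le_admissible:
  assumes "\<epsilon> > 0" "admissible_speed f \<epsilon> c"
  shows "limit_speed f \<le> c"
  unfolding limit_speed_def
proof (rule cSUP_least)
  fix v :: real assume v: "v \<in> {0<..1}"
  obtain y where y: "backward_solution f \<epsilon> c y" "y 0 = 0" "\<forall>v\<in>{0<..<1}. y v > 0"
    using assms by (auto simp: admissible_speed_altdef)
  have "0 \<le> y v" using y v by (cases "v = 1") (auto simp: backward_solution_def less_imp_le)
  then show "primitive f v / v \<le> c"
    using solution_le_line[OF assms(1) admissible_speed_nonneg[OF assms] y(1), of v] y(2) v
    by (auto simp: field_simps)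
qed auto


section \<open>Subsolutions\<close>

text \<open>
  Since the flux vanishes at \<open>0\<close>, the subsolution needs a special shape there. The function
  \<open>z v = sqrt (\<epsilon>\<^sup>2 + (l v)\<^sup>2) - \<epsilon>\<close> solves \<open>z' = l g(z)\<close>, and the surplus \<open>(c - l) g(z)\<close>
  dominates \<open>f v \<le> k v\<close> on \<open>[0, \<delta>]\<close> by the smallness condition.
\<close>

lemma subsolution_at_0:
  assumes "\<epsilon> > 0" "0 < l" "l < c" and \<delta>: "0 < \<delta>" "\<delta> \<le> 1"
    and small: "k * sqrt (\<epsilon>\<^sup>2 + (l * \<delta>)\<^sup>2) \<le> (c - l) * l"
    and y: "backward_solution f \<epsilon> c y" and y_\<delta>: "y \<delta> \<le> sqrt (\<epsilon>\<^sup>2 + (l * \<delta>)\<^sup>2) - \<epsilon>"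
  shows "y 0 \<le> 0"
proof -
  define r where "r v = sqrt (\<epsilon>\<^sup>2 + (l * v)\<^sup>2)" for v
  have r_pos: "0 < r v" for v using assms(1) by (simp add: r_def add_pos_nonneg)
  have r_sq: "(r v)\<^sup>2 = \<epsilon>\<^sup>2 + (l * v)\<^sup>2" for v by (simp add: r_def)
  have r_ge: "\<epsilon> \<le> r v" for v
    unfolding r_def by (rule real_le_rsqrt) simp
  have flux_r: "flux \<epsilon> (r v - \<epsilon>) = l * v / r v" if "0 \<le> v" for v
  proof -
    have "(r v - \<epsilon>) * (2 * \<epsilon> + (r v - \<epsilon>)) = (r v)\<^sup>2 - \<epsilon>\<^sup>2" by algebra
    also have "\<dots> = (l * v)\<^sup>2" by (simp add: r_sq)
    finally show ?thesis using r_ge[of v] that assms(2) by (simp add: flux_def max_def)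
  qed
  have "y 0 \<le> r 0 - \<epsilon>"
  proof (rule backward_comparison[OF assms(1) _ order_refl \<delta>(2) y,
        where z = "\<lambda>v. r v - \<epsilon>" and z' = "\<lambda>v. l * (l * v / r v)"])
    show "continuous_on {0..\<delta>} (\<lambda>v. r v - \<epsilon>)" unfolding r_def by (intro continuous_intros)
    fix v assume v: "0 < v" "v < \<delta>"
    have pos: "\<epsilon>\<^sup>2 + (l * v)\<^sup>2 > 0" using assms(1) by (simp add: add_pos_nonneg)
    show "((\<lambda>v. r v - \<epsilon>) has_real_derivative l * (l * v / r v)) (at v)"
    proof -
      have "((\<lambda>v. \<epsilon>\<^sup>2 + (l * v)\<^sup>2) has_real_derivative 2 * (l * (l * v))) (at v)"
        by (auto intro!: derivative_eq_intros)
      then have "((\<lambda>v. r v - \<epsilon>) has_real_derivative inverse (r v) / 2 * (2 * (l * (l * v))) - 0) (at v)"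
        unfolding r_def by (intro DERIV_diff DERIV_const
              DERIV_chain2[where f = sqrt and g = "\<lambda>v. \<epsilon>\<^sup>2 + (l * v)\<^sup>2", OF DERIV_real_sqrt[OF pos]])
      moreover have "inverse (r v) / 2 * (2 * (l * (l * v))) - 0 = l * (l * v / r v)"
        using r_pos[of v] by (simp add: field_simps)
      ultimately show ?thesis by simp
    qed
    have "r v \<le> r \<delta>"
      unfolding r_def using v assms(2) by (auto intro!: power_mono)
    then have "k * r v \<le> k * r \<delta>" using k_pos by simp
    also have "\<dots> \<le> (c - l) * l" using small by (simp add: r_def)
    finally have "k * r v \<le> (c - l) * l" .
    then have "k * r v * v \<le> (c - l) * l * v" using v by (intro mult_right_mono) auto
    then have "k * v \<le> (c - l) * (l * v / r v)" using r_pos[of v] by (simp add: field_simps)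
    moreover have "f v \<le> k * v" using f_bound[of v] v \<delta> by auto
    ultimately show "l * (l * v / r v) \<le> c * flux \<epsilon> (r v - \<epsilon>) - f v"
      using flux_r[of v] v left_diff_distrib[of c l "l * v / r v"] by simp
  qed (use assms in \<open>auto simp: r_def\<close>)
  then show ?thesis using assms(1) by (simp add: r_def)
qed

text \<open>
  Above the limiting speed, and for small \<open>\<epsilon>\<close>, a subsolution vanishing at \<open>0\<close> is glued from
  two pieces, which forces \<open>y 0 \<le> 0\<close>.
\<close>

lemma eventually_nonpos_at_0:
  assumes "limit_speed f < c"
  shows "\<forall>\<^sub>F \<epsilon> in at_right 0. \<forall>y. backward_solution f \<epsilon> c y \<longrightarrow> y 0 \<le> 0"
proof -
  define L l \<eta> where "L = limit_speed f" and "l = (L + c) / 2" and "\<eta> = (c - L) / 2"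
  have \<eta>: "0 < \<eta>" "l - L = \<eta>" "c - l = \<eta>" and L: "0 < L" and l: "0 < l" "l < c"
    using assms limit_speed_pos by (auto simp: L_def l_def \<eta>_def field_simps)
  \<comment> \<open>Small enough that \<open>k \<delta> \<le> \<eta> / 2\<close>, which makes the first piece
    a subsolution for small \<open>\<epsilon>\<close> and keeps the second one positive.\<close>
  define \<delta> where "\<delta> = min (1 / 2) (\<eta> / (2 * k))"
  have \<delta>: "0 < \<delta>" "\<delta> < 1" using \<eta> k_pos by (auto simp: \<delta>_def)
  have "\<delta> \<le> \<eta> / (2 * k)" by (simp add: \<delta>_def)
  then have k\<delta>: "k * \<delta> \<le> \<eta> / 2" using k_pos by (simp add: field_simps)
  define m where "m = \<eta> * \<delta> / 2"
  have m: "0 < m" using \<eta> \<delta> by (simp add: m_def)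
  have "((\<lambda>\<epsilon>. k * sqrt (\<epsilon>\<^sup>2 + (l * \<delta>)\<^sup>2)) \<longlongrightarrow> k * sqrt (0\<^sup>2 + (l * \<delta>)\<^sup>2)) (at_right 0)"
    by (intro tendsto_intros)
  moreover have "k * sqrt (0\<^sup>2 + (l * \<delta>)\<^sup>2) < (c - l) * l"
  proof -
    have "k * sqrt (0\<^sup>2 + (l * \<delta>)\<^sup>2) = (k * \<delta>) * l" using l \<delta> by simp
    also have "\<dots> < \<eta> * l" using k\<delta> \<eta> l by (intro mult_strict_right_mono) auto
    finally show ?thesis by (simp add: \<eta>)
  qed
  ultimately have ev1: "\<forall>\<^sub>F \<epsilon> in at_right 0. k * sqrt (\<epsilon>\<^sup>2 + (l * \<delta>)\<^sup>2) < (c - l) * l"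
    by (rule order_tendstoD)
  have ev2: "\<forall>\<^sub>F \<epsilon> in at_right 0. l / c < flux \<epsilon> (m / 2)"
    using m l by (intro order_tendstoD[OF tendsto_flux_at_right_0]) auto
  have ev3: "\<forall>\<^sub>F \<epsilon> in at_right 0. \<epsilon> \<in> {0<..<m / 2}"
    using m by (intro eventually_at_right_real) auto
  show ?thesis
    using ev1 ev2 ev3
  proof eventually_elim
    case (elim \<epsilon>)
    then have \<epsilon>: "0 < \<epsilon>" "\<epsilon> < m / 2" by auto
    show ?case
    proof (intro allI impI)
      fix y assume y: "backward_solution f \<epsilon> c y"
      \<comment> \<open>The second piece, with slope \<open>l - f\<close>, starts at \<open>\<delta>\<close>
        from the value of the first one.\<close>
      define b where "b v = sqrt (\<epsilon>\<^sup>2 + (l * \<delta>)\<^sup>2) - \<epsilon> + l * (v - \<delta>) - (primitive f v - primitive f \<delta>)" for v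
      have b_ge: "m / 2 \<le> b v" if v: "\<delta> \<le> v" "v \<le> 1" for v
      proof -
        have "l * \<delta> \<le> sqrt (\<epsilon>\<^sup>2 + (l * \<delta>)\<^sup>2)" by (rule real_le_rsqrt) simp
        moreover have "primitive f v \<le> L * v" using primitive_le_limit_speed[of v] v \<delta> by (simp add: L_def)
        moreover have "- primitive f \<delta> \<le> m"
        proof -
          have "- primitive f \<delta> \<le> k * \<delta> * \<delta>" using abs_primitive_le[of \<delta>] \<delta> by auto
          also have "\<dots> \<le> \<eta> / 2 * \<delta>" using k\<delta> \<delta> by (intro mult_right_mono) auto
          finally show ?thesis by (simp add: m_def)
        qed
        moreover have "2 * m \<le> l * v - L * v"
        proof -
          have "2 * m = \<eta> * \<delta>" by (simp add: m_def)
          also have "\<dots> \<le> \<eta> * v" using v \<eta> by simp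
          also have "\<dots> = l * v - L * v" by (simp flip: \<eta>(2) add: left_diff_distrib)
          finally show ?thesis .
        qed
        moreover have "l * (v - \<delta>) = l * v - l * \<delta>" by (simp add: right_diff_distrib)
        ultimately show ?thesis using \<epsilon> unfolding b_def by linarith
      qed
      have "y \<delta> \<le> b \<delta>"
      proof (rule backward_comparison[OF \<epsilon>(1) _ _ order_refl y, where a = \<delta> and z' = "\<lambda>v. l - f v"])
        show "continuous_on {\<delta>..1} b"
          unfolding b_def using \<delta> by (intro continuous_intros continuous_on_subset[OF primitive_cont]) auto
        fix v assume v: "\<delta> < v" "v < 1"
        show "(b has_real_derivative l - f v) (at v)"
          unfolding b_def using v \<delta> by (auto intro!: derivative_eq_intros primitive_DERIV)
        have "flux \<epsilon> (m / 2) \<le> flux \<epsilon> (b v)"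
          using b_ge[of v] v by (intro flux_mono \<epsilon>) auto
        then have "l / c \<le> flux \<epsilon> (b v)" using elim by linarith
        then show "l - f v \<le> c * flux \<epsilon> (b v) - f v" using l by (simp add: field_simps)
      next
        show "y 1 \<le> b 1" using b_ge[of 1] y m \<delta> by (simp add: backward_solution_def)
      qed (use l \<delta> in auto)
      then have "y \<delta> \<le> sqrt (\<epsilon>\<^sup>2 + (l * \<delta>)\<^sup>2) - \<epsilon>" by (simp add: b_def)
      then show "y 0 \<le> 0"
        using elim \<delta> by (intro subsolution_at_0[OF \<epsilon>(1) l \<delta>(1) _ _ y]) auto
    qed
  qed
qed

section \<open>The minimal speed\<close>

text \<open>
  The nonnegative speeds whose backward solution has come down to \<open>0\<close> at the left end (or below it).
\<close>

definition reaching_speeds :: "real \<Rightarrow> real set" where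
  "reaching_speeds \<epsilon> = {c. 0 \<le> c \<and> (\<exists>y. backward_solution f \<epsilon> c y \<and> y 0 \<le> 0)}"

text \<open>
  The critical speed; for \<open>\<epsilon> > 0\<close> the infimum is attained.
\<close>

definition min_speed :: "real \<Rightarrow> real" where
  "min_speed \<epsilon> = Inf (reaching_speeds \<epsilon>)"

lemma reaching_speeds_lower_bound:
  assumes "\<epsilon> > 0" "c \<in> reaching_speeds \<epsilon>"
  shows "primitive f 1 \<le> c"
proof -
  obtain y where "0 \<le> c" "backward_solution f \<epsilon> c y" "y 0 \<le> 0"
    using assms(2) by (auto simp: reaching_speeds_def)
  then show ?thesis
    using solution_le_line[OF assms(1), of c y 1] by (simp add: backward_solution_def)
qed

lemma reaching_speeds_nonempty:
  assumes "\<epsilon> > 0"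
  shows "1 + k * sqrt (\<epsilon>\<^sup>2 + 1) \<in> reaching_speeds \<epsilon>"
proof -
  let ?c = "1 + k * sqrt (\<epsilon>\<^sup>2 + 1)"
  obtain y where y: "backward_solution f \<epsilon> ?c y"
    using backward_solution_exists[OF assms f_cont] by blast
  have "0 < sqrt (\<epsilon>\<^sup>2 + 1)" by (simp add: add_nonneg_pos)
  then have pos: "0 < k * sqrt (\<epsilon>\<^sup>2 + 1)" using k_pos by simp
  have "\<epsilon> \<le> sqrt (\<epsilon>\<^sup>2 + 1)" by (rule real_le_rsqrt) simp
  then have "y 0 \<le> 0"
    using y pos by (intro subsolution_at_0[OF assms zero_less_one _ zero_less_one order_refl _ y])
       (auto simp: backward_solution_def)
  then show ?thesis using y pos by (auto simp: reaching_speeds_def)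
qed

lemma bdd_below_reaching_speeds: "bdd_below (reaching_speeds \<epsilon>)"
  by (rule bdd_belowI[of _ 0]) (simp add: reaching_speeds_def)

lemma min_speed_pos:
  assumes "\<epsilon> > 0"
  shows "0 < min_speed \<epsilon>"
proof -
  have "primitive f 1 \<le> min_speed \<epsilon>"
    unfolding min_speed_def using reaching_speeds_nonempty[OF assms] reaching_speeds_lower_bound[OF assms]
    by (intro cInf_greatest) auto
  then show ?thesis using primitive_1_pos by linarith
qed

lemma min_speed_reaching:
  assumes "\<epsilon> > 0"
  shows "min_speed \<epsilon> \<in> reaching_speeds \<epsilon>"
proof -
  obtain y where y: "backward_solution f \<epsilon> (min_speed \<epsilon>) y"
    using backward_solution_exists[OF assms f_cont] by blast
  have "y 0 \<le> 0"
  proof (rule field_le_epsilon)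
    fix e :: real assume "0 < e"
    then obtain c where c: "c \<in> reaching_speeds \<epsilon>" "c < min_speed \<epsilon> + e"
      using cInf_lessD[of "reaching_speeds \<epsilon>" "min_speed \<epsilon> + e"] reaching_speeds_nonempty[OF assms]
      by (auto simp: min_speed_def)
    then obtain yc where yc: "backward_solution f \<epsilon> c yc" "yc 0 \<le> 0"
      by (auto simp: reaching_speeds_def)
    have "min_speed \<epsilon> \<le> c" unfolding min_speed_def by (intro cInf_lower c bdd_below_reaching_speeds)
    then have "y 0 \<le> yc 0 + (c - min_speed \<epsilon>) * (1 - 0)"
      using min_speed_pos[OF assms] by (intro solution_lipschitz[OF assms _ _ y yc(1)]) auto
    then show "y 0 \<le> 0 + e" using yc c by simp
  qed
  then show ?thesis using y min_speed_pos[OF assms] by (auto simp: reaching_speeds_def)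
qed

lemma reaching_speeds_eq:
  assumes "\<epsilon> > 0"
  shows "reaching_speeds \<epsilon> = {min_speed \<epsilon>..}"
proof (intro equalityI subsetI)
  fix c assume "c \<in> reaching_speeds \<epsilon>"
  then show "c \<in> {min_speed \<epsilon>..}"
    unfolding min_speed_def by (auto intro: cInf_lower bdd_below_reaching_speeds)
next
  fix c assume c: "c \<in> {min_speed \<epsilon>..}"
  obtain y where y: "backward_solution f \<epsilon> (min_speed \<epsilon>) y" "y 0 \<le> 0"
    using min_speed_reaching[OF assms] by (auto simp: reaching_speeds_def)
  obtain yc where yc: "backward_solution f \<epsilon> c yc"
    using backward_solution_exists[OF assms f_cont] by blast
  have "yc 0 \<le> y 0"
    using c min_speed_pos[OF assms] by (intro solution_antimono[OF assms _ _ y(1) yc]) auto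
  then show "c \<in> reaching_speeds \<epsilon>"
    using y yc c min_speed_pos[OF assms] by (auto simp: reaching_speeds_def)
qed

lemma admissible_reaching:
  assumes "\<epsilon> > 0" "admissible_speed f \<epsilon> c"
  shows "min_speed \<epsilon> \<le> c"
proof -
  have "c \<in> reaching_speeds \<epsilon>"
    using assms admissible_speed_nonneg[OF assms] by (force simp: reaching_speeds_def admissible_speed_altdef)
  then show ?thesis using reaching_speeds_eq[OF assms(1)] by simp
qed

lemma admissible_if_pos:
  assumes "backward_solution f \<epsilon> c y" "y 0 \<le> 0" "\<And>v. \<lbrakk>0 < v; v < 1\<rbrakk> \<Longrightarrow> 0 < y v"
  shows "admissible_speed f \<epsilon> c"
proof -
  have closure: "closure {0<..<1::real} = {0..1}" by (rule closure_greaterThanLessThan) simp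
  have "continuous_on (closure {0<..<1}) y"
    unfolding closure by (rule backward_solution_cont[OF assms(1)])
  moreover have "0 \<in> closure {0<..<1::real}" unfolding closure by simp
  moreover have "0 \<le> y v" if "v \<in> {0<..<1}" for v using assms(3)[of v] that by simp
  ultimately have "0 \<le> y 0" by (rule continuous_ge_on_closure)
  then have "y 0 = 0" using assms(2) by (rule antisym[rotated])
  moreover have "\<forall>v\<in>{0<..<1}. 0 < y v" using assms(3) by simp
  ultimately show ?thesis using assms(1) unfolding admissible_speed_altdef by blast
qed

section \<open>Admissible speeds\<close>

text \<open>
  On \<open>[0, \<alpha>]\<close>, where \<open>f \<le> 0\<close>, the potential \<open>sqrt (y (2 \<epsilon> + y))\<close> grows at least with rate \<open>c\<close>. In
  contrast to the mere positivity of \<open>y\<close>, this bound persists under limits in \<open>c\<close>.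
\<close>

lemma flux_potential_growth:
  assumes "\<epsilon> > 0" and y: "backward_solution f \<epsilon> c y"
    and v: "0 < v" "v \<le> \<alpha>" and pos: "\<And>s. \<lbrakk>0 < s; s \<le> \<alpha>\<rbrakk> \<Longrightarrow> 0 < y s" and y0: "0 \<le> y 0"
  shows "c * v \<le> sqrt (y v * (2 * \<epsilon> + y v))"
proof -
  let ?H = "\<lambda>v. sqrt (y v * (2 * \<epsilon> + y v)) - c * v"
  have "?H 0 \<le> ?H v"
  proof (rule DERIV_nonneg_imp_increasing_open[where f = ?H])
    fix s assume s: "0 < s" "s < v"
    show "\<exists>d. (?H has_real_derivative d) (at s) \<and> 0 \<le> d"
    proof (intro exI conjI)
      show "(?H has_real_derivative (c - f s / flux \<epsilon> (y s) - c)) (at s)"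
        using s v \<alpha> by (intro DERIV_diff DERIV_cmult_Id flux_potential_deriv assms(1) pos
            backward_solution_DERIV[OF y]) auto
      show "0 \<le> c - f s / flux \<epsilon> (y s) - c"
        using s v f_left[of s] flux_nonneg[OF assms(1), of "y s"] by (simp add: divide_nonpos_nonneg)
    qed
  next
    show "continuous_on {0..v} ?H"
      using v \<alpha> by (intro continuous_intros continuous_on_subset[OF backward_solution_cont[OF y]]) auto
  qed (use v in auto)
  moreover have "0 \<le> sqrt (y 0 * (2 * \<epsilon> + y 0))" using y0 assms(1) by simp
  ultimately show ?thesis by (simp del: real_sqrt_ge_0_iff)
qed

text \<open>
  For type B the solution at the minimal speed could a priori vanish on an initial interval, as
  \<open>0\<close> solves the equation there. This is excluded by approaching the minimal speed
  from below: for \<open>c = c\<^sup>* - d\<close> the solution starts from a positive value at \<open>0\<close>, hence its potential at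
  \<open>v \<le> \<alpha>\<close> is at least \<open>c v\<close>.
\<close>

lemma min_speed_solution_pos:
  assumes "\<epsilon> > 0" and y: "backward_solution f \<epsilon> (min_speed \<epsilon>) y" and v: "0 < v" "v < 1"
  shows "0 < y v"
proof (cases "\<alpha> < v")
  case True then show ?thesis using solution_pos_right[OF assms(1) y] v by simp
next
  case False
  show ?thesis
  proof (rule ccontr)
    assume "\<not> 0 < y v"
    define m where "m = min_speed \<epsilon>"
    have m: "0 < m" using min_speed_pos[OF assms(1)] by (simp add: m_def)
    \<comment> \<open>If \<open>y v \<le> 0\<close>, the solution for the speed \<open>m - d\<close> is at
      most \<open>d\<close> at \<open>v\<close>, and its potential is at least
      \<open>(m - d) v\<close>.\<close>
    have ineq: "(m - d) * v \<le> sqrt (d * (2 * \<epsilon> + d))" if d: "0 < d" "d < m" for d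
    proof -
      obtain w where w: "backward_solution f \<epsilon> (m - d) w"
        using backward_solution_exists[OF assms(1) f_cont] by blast
      have "m - d \<notin> reaching_speeds \<epsilon>" using reaching_speeds_eq[OF assms(1)] d by (simp add: m_def)
      then have w0: "0 < w 0" using w d by (auto simp: reaching_speeds_def not_le)
      have w_pos: "0 < w s" if s: "0 < s" "s \<le> \<alpha>" for s
      proof -
        have "w 0 \<le> w s"
        proof (rule DERIV_nonneg_imp_increasing_open[where f = w])
          fix x assume x: "0 < x" "x < s"
          have "0 \<le> (m - d) * flux \<epsilon> (w x) - f x"
            using x s f_left[of x] flux_nonneg[OF assms(1), of "w x"] d
            by (smt (verit) mult_nonneg_nonneg)
          moreover have "(w has_real_derivative (m - d) * flux \<epsilon> (w x) - f x) (at x)"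
            using x s \<alpha> by (intro backward_solution_DERIV[OF w]) auto
          ultimately show "\<exists>D. (w has_real_derivative D) (at x) \<and> 0 \<le> D" by blast
        qed (use s \<alpha> in \<open>auto intro: continuous_on_subset[OF backward_solution_cont[OF w]]\<close>)
        then show ?thesis using w0 by simp
      qed
      have "w v \<le> y v + (m - (m - d)) * (1 - v)"
        using d v by (intro solution_lipschitz[OF assms(1) _ _ w y[folded m_def]]) auto
      also have "\<dots> \<le> d" using \<open>\<not> 0 < y v\<close> d v by (simp add: algebra_simps) (smt (verit) mult_nonneg_nonneg)
      finally have "w v \<le> d" .
      have "(m - d) * v \<le> sqrt (w v * (2 * \<epsilon> + w v))"
        using False v w0 w_pos by (intro flux_potential_growth[OF assms(1) w]) auto
      also have "\<dots> \<le> sqrt (d * (2 * \<epsilon> + d))"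
        using \<open>w v \<le> d\<close> w_pos[of v] False v assms(1)
        by (intro real_sqrt_le_mono mult_mono) auto
      finally show ?thesis .
    qed
    have "(m - 0) * v \<le> sqrt (0 * (2 * \<epsilon> + 0))"
    proof (rule tendsto_le)
      show "((\<lambda>d. (m - d) * v) \<longlongrightarrow> (m - 0) * v) (at_right 0)" by (intro tendsto_intros)
      show "((\<lambda>d. sqrt (d * (2 * \<epsilon> + d))) \<longlongrightarrow> sqrt (0 * (2 * \<epsilon> + 0))) (at_right 0)"
        by (intro tendsto_intros)
      show "\<forall>\<^sub>F d in at_right 0. (m - d) * v \<le> sqrt (d * (2 * \<epsilon> + d))"
        using eventually_at_right_real[OF m] by eventually_elim (auto intro: ineq)
    qed auto
    then have "m * v \<le> 0" by simp
    then show False using mult_pos_pos[OF m v(1)] by linarith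
  qed
qed

lemma min_speed_admissible:
  assumes "\<epsilon> > 0"
  shows "admissible_speed f \<epsilon> (min_speed \<epsilon>)"
proof -
  obtain y where "backward_solution f \<epsilon> (min_speed \<epsilon>) y" "y 0 \<le> 0"
    using min_speed_reaching[OF assms] by (auto simp: reaching_speeds_def)
  then show ?thesis using min_speed_solution_pos[OF assms] by (blast intro: admissible_if_pos)
qed

lemma admissible_speeds_monostable:
  assumes "\<epsilon> > 0" "\<alpha> = 0"
  shows "{c. admissible_speed f \<epsilon> c} = {min_speed \<epsilon>..}"
proof (intro equalityI subsetI)
  fix c assume "c \<in> {min_speed \<epsilon>..}"
  then obtain y where y: "backward_solution f \<epsilon> c y" "y 0 \<le> 0"
    using reaching_speeds_eq[OF assms(1)] by (auto simp: reaching_speeds_def)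
  have "admissible_speed f \<epsilon> c"
    using solution_pos_right[OF assms(1) y(1)] assms(2) by (intro admissible_if_pos[OF y]) auto
  then show "c \<in> {c. admissible_speed f \<epsilon> c}" by simp
qed (use admissible_reaching[OF assms(1)] in auto)

text \<open>
  Let \<open>c1 < c2\<close> be admissible with solutions \<open>y1\<close> and \<open>y2\<close>. Comparison from the right end gives
  \<open>y2 \<le> y1\<close>. With \<open>f \<le> 0\<close> on \<open>[0, \<alpha>]\<close>, this implies that the potential of \<open>y2\<close> grows strictly faster from \<open>0\<close>
  than that of \<open>y1\<close>, so \<open>y2 > y1\<close> at \<open>\<alpha>\<close>.
\<close>

lemma admissible_speed_unique:
  assumes "\<epsilon> > 0" "0 < \<alpha>" "admissible_speed f \<epsilon> c1" "admissible_speed f \<epsilon> c2"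
  shows "c2 \<le> c1"
proof (rule ccontr)
  assume "\<not> c2 \<le> c1"
  obtain y1 where y1: "backward_solution f \<epsilon> c1 y1" "y1 0 = 0" "\<forall>v\<in>{0<..<1}. y1 v > 0"
    using assms(3) by (auto simp: admissible_speed_altdef)
  obtain y2 where y2: "backward_solution f \<epsilon> c2 y2" "y2 0 = 0" "\<forall>v\<in>{0<..<1}. y2 v > 0"
    using assms(4) by (auto simp: admissible_speed_altdef)
  have le: "y2 v \<le> y1 v" if "0 \<le> v" "v \<le> 1" for v
    using that \<open>\<not> c2 \<le> c1\<close> admissible_speed_nonneg[OF assms(1,3)]
    by (intro solution_antimono[OF assms(1) _ _ y1(1) y2(1)]) auto
  let ?D = "\<lambda>v. sqrt (y2 v * (2 * \<epsilon> + y2 v)) - sqrt (y1 v * (2 * \<epsilon> + y1 v))"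
  have "?D 0 < ?D \<alpha>"
  proof (rule DERIV_pos_imp_increasing_open[OF assms(2), where f = ?D])
    fix s assume s: "0 < s" "s < \<alpha>"
    then have s1: "s < 1" using \<alpha> by simp
    have pos: "0 < y1 s" "0 < y2 s" using s s1 y1 y2 by auto
    have "flux \<epsilon> (y2 s) \<le> flux \<epsilon> (y1 s)" using le s s1 by (intro flux_mono assms) auto
    then have "f s / flux \<epsilon> (y2 s) \<le> f s / flux \<epsilon> (y1 s)"
      using s f_left[of s] flux_pos[OF assms(1)] pos by (intro divide_left_mono_neg) (auto simp: mult_pos_pos)
    then have "0 < (c2 - f s / flux \<epsilon> (y2 s)) - (c1 - f s / flux \<epsilon> (y1 s))"
      using \<open>\<not> c2 \<le> c1\<close> by linarith
    moreover have "(?D has_real_derivative (c2 - f s / flux \<epsilon> (y2 s)) - (c1 - f s / flux \<epsilon> (y1 s))) (at s)"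
      using s s1 by (intro DERIV_diff flux_potential_deriv assms(1) pos backward_solution_DERIV y1 y2)
    ultimately show "\<exists>d. (?D has_real_derivative d) (at s) \<and> 0 < d" by blast
  next
    show "continuous_on {0..\<alpha>} ?D"
      using \<alpha> by (intro continuous_intros continuous_on_subset[OF backward_solution_cont[OF y1(1)]]
         continuous_on_subset[OF backward_solution_cont[OF y2(1)]]) auto
  qed
  moreover have "?D \<alpha> \<le> 0"
  proof -
    have "0 < y2 \<alpha>" "y2 \<alpha> \<le> y1 \<alpha>" using assms(2) \<alpha> y2 le by auto
    then have "y2 \<alpha> * (2 * \<epsilon> + y2 \<alpha>) \<le> y1 \<alpha> * (2 * \<epsilon> + y1 \<alpha>)"
      using assms(1) by (intro mult_mono) auto
    then show ?thesis by simp
  qed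
  ultimately show False using y1 y2 by simp
qed

lemma admissible_speeds_bistable:
  assumes "\<epsilon> > 0" "0 < \<alpha>"
  shows "{c. admissible_speed f \<epsilon> c} = {min_speed \<epsilon>}"
proof (intro equalityI subsetI)
  fix c assume "c \<in> {c. admissible_speed f \<epsilon> c}"
  then have c: "admissible_speed f \<epsilon> c" by simp
  have "c = min_speed \<epsilon>"
    using admissible_speed_unique[OF assms min_speed_admissible[OF assms(1)] c]
      admissible_reaching[OF assms(1) c] by (rule antisym)
  then show "c \<in> {min_speed \<epsilon>}" by simp
qed (use min_speed_admissible[OF assms(1)] in simp)

section \<open>Convergence of the critical speeds\<close>

lemma min_speed_tendsto: "(min_speed \<longlongrightarrow> limit_speed f) (at_right 0)"
proof (rule order_tendstoI)
  fix a assume "a < limit_speed f"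
  moreover have "\<forall>\<^sub>F \<epsilon> in at_right 0. limit_speed f \<le> min_speed \<epsilon>"
    using eventually_at_right_less by eventually_elim (rule limit_speed_le_admissible[OF _ min_speed_admissible])
  ultimately show "\<forall>\<^sub>F \<epsilon> in at_right 0. a < min_speed \<epsilon>" by (auto elim: eventually_mono)
next
  fix a assume "limit_speed f < a"
  then obtain c where c: "limit_speed f < c" "c < a" using dense by blast
  show "\<forall>\<^sub>F \<epsilon> in at_right 0. min_speed \<epsilon> < a"
    using eventually_nonpos_at_0[OF c(1)] eventually_at_right_less
  proof eventually_elim
    case (elim \<epsilon>)
    obtain y where "backward_solution f \<epsilon> c y"
      using backward_solution_exists[OF elim(2) f_cont] by blast
    then have "c \<in> reaching_speeds \<epsilon>"
      using elim c limit_speed_pos by (auto simp: reaching_speeds_def)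
    then show ?case using reaching_speeds_eq[OF elim(2)] c by simp
  qed
qed

end

lemma type_A_not_B_C:
  assumes "type_A f"
  shows "\<not> type_B f" "\<not> type_C f"
proof -
  show "\<not> type_B f"
  proof
    assume "type_B f"
    then obtain \<alpha> where "0 < \<alpha>" "\<alpha> < 1" "f \<alpha> = 0"
      unfolding type_B_def by force
    then show False using assms unfolding type_A_def by (auto dest!: bspec[of _ _ \<alpha>])
  qed
  show "\<not> type_C f"
  proof
    assume "type_C f"
    then obtain \<alpha> where "0 < \<alpha>" "\<alpha> < 1" "f (\<alpha> / 2) < 0"
      unfolding type_C_def by force
    then show False using assms unfolding type_A_def by (auto dest!: bspec[of _ _ "\<alpha> / 2"])
  qed
qed

theorem proposition22:
  fixes f :: "real \<Rightarrow> real" and k :: real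
  assumes "continuous_on {0..1} f"
    and "type_A f \<or> type_B f \<or> type_C f"
    and "f 0 = 0" and "f 1 = 0"
    and "integral {0..1} f > 0"
    and "k > 0"
    and "\<And>s. s \<in> {0..1} \<Longrightarrow> \<bar>f s\<bar> \<le> k * s"
    and "\<And>s. s \<in> {0..1} \<Longrightarrow> \<bar>f s\<bar> \<le> k * (1 - s)"
  shows "\<exists>cbar>0. (critical_speed f \<longlongrightarrow> cbar) (at_right 0)"
proof -
  obtain \<alpha> where \<alpha>: "0 \<le> \<alpha>" "\<alpha> < 1" and \<alpha>_type: "\<alpha> = 0 \<longleftrightarrow> type_A f"
    and left: "\<And>s. \<lbrakk>0 \<le> s; s \<le> \<alpha>\<rbrakk> \<Longrightarrow> f s \<le> 0" and right: "\<And>s. \<lbrakk>\<alpha> < s; s < 1\<rbrakk> \<Longrightarrow> 0 < f s"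
  proof -
    consider "type_A f" | "type_B f" "\<not> type_A f" | "type_C f" "\<not> type_A f"
      using assms(2) by blast
    then show thesis
    proof cases
      case 1
      then show thesis using assms(3) by (intro that[of 0]) (auto simp: type_A_def)
    next
      case 2
      then obtain a where "a \<in> {0<..<1}" "\<forall>u\<in>{0..a}. f u = 0" "\<forall>u\<in>{a<..<1}. f u > 0"
        unfolding type_B_def by blast
      then show thesis using 2 by (intro that[of a]) auto
    next
      case 3
      then obtain a where a: "a \<in> {0<..<1}" "\<forall>u\<in>{0<..<a}. f u < 0" "\<forall>u\<in>{a<..<1}. f u > 0"
        unfolding type_C_def by blast
      have "f s \<le> 0" if "s \<in> {0..a}" for s
      proof (rule continuous_le_on_closure[of "{0<..<a}" f])
        show "continuous_on (closure {0<..<a}) f"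
          using a by (auto intro: continuous_on_subset[OF assms(1)])
      qed (use a that in \<open>auto intro: less_imp_le\<close>)
      then show thesis using a 3 by (intro that[of a]) auto
    qed
  qed
  interpret threshold_reaction f k \<alpha>
    by (rule threshold_reaction.intro) (fact assms \<alpha> left right)+
  have critical: "critical_speed f \<epsilon> = min_speed \<epsilon>" if \<epsilon>: "\<epsilon> > 0" for \<epsilon>
  proof (cases "type_A f")
    case True
    then have "{c. admissible_speed f \<epsilon> c} = {min_speed \<epsilon>..}"
      using \<alpha>_type by (intro admissible_speeds_monostable[OF \<epsilon>]) blast
    with True show ?thesis
      using type_A_not_B_C[OF True]
      unfolding critical_speed_def by (intro the_equality) auto
  next
    case False
    then have "{c. admissible_speed f \<epsilon> c} = {min_speed \<epsilon>}"
      using \<alpha> \<alpha>_type by (intro admissible_speeds_bistable[OF \<epsilon>]) (auto simp: less_le)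
    with False show ?thesis
      using assms(2)
      unfolding critical_speed_def by (intro the_equality) auto
  qed
  have "(critical_speed f \<longlongrightarrow> limit_speed f) (at_right 0)"
    by (rule Lim_transform_eventually[OF min_speed_tendsto])
       (use eventually_at_right_less in \<open>eventually_elim, simp add: critical\<close>)
  then show ?thesis using limit_speed_pos by blast
qed

end
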